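(* Let $G$ be a finite group and let $\pi(G)$ denote the set of prime divisors of $|G|$. Then $G$ is supersoluble if and only if for every prime $p\in\pi(G)$ there exists a supersoluble subgroup $H\le G$ with $|G:H|=p$.
   Context: All groups are finite. A group is supersoluble if it has a normal series with all factors cyclic of prime order (equivalently, a chief series with all chief factors of prime order). *)

theory Defs
  imports "HOL-Algebra.Algebra"
begin

definition supersoluble :: "('a, 'b) monoid_scheme \<Rightarrow> bool" where
  "supersoluble G \<longleftrightarrow>
     (\<exists>Hs :: 'a set list. Hs \<noteq> [] \<and> hd Hs = {\<one>\<^bsub>G\<^esub>} \<and> last Hs = carrier G \<and>
        (\<forall>i < length Hs. Hs ! i \<lhd> G) \<and>
        (\<forall>i. Suc i < length Hs \<longrightarrow>
            Hs ! i \<subseteq> Hs ! Suc i \<and>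
            cyclic_group ((G\<lparr>carrier := Hs ! Suc i\<rparr>) Mod (Hs ! i)) \<and>
            Factorial_Ring.prime (order ((G\<lparr>carrier := Hs ! Suc i\<rparr>) Mod (Hs ! i)))))"

end

theory Submission
  imports Defs
begin

text \<open>
  In a supersoluble group, a normal subgroup $N$ of prime order allows induction through $G/N$ unless
  $|N| = p$ and $p$ does not divide $|G/N|$. Then take $K/N$ normal of prime order $r$ in $G/N$ and
  $R \le K$ of order $r$: by a Frattini argument either the normalizer of $R$ has index $p$, or $R$ is
  normal and $G/R$ serves instead.

  Conversely, a supersoluble subgroup whose index is the smallest prime divisor is normal, and its
  Sylow subgroup for the largest prime $q$ yields a normal Sylow $q$-subgroup $Q$ of $G$. Let $H$ be
  supersoluble of index $q$ and $Z$ the centre of $Q$. If $Z \cap H = 1$, then $|Z| = q$; otherwise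
  $Z \cap H$ contains a subgroup $L$ of prime order normal in $H$, which $Q$ centralizes, so that $L$
  is normal in $QH = G$. In both cases $G$ has a normal subgroup of prime order, and the hypothesis
  passes to the quotient by it, unless the quotient is an image of one of the given subgroups and
  hence supersoluble anyway.
\<close>

hide_const (open) Divisibility.prime

section \<open>Counting subgroups, products and fibres in finite groups\<close>

lemma card_eq_card_image_mult:
  assumes "finite A" "\<And>y. y \<in> f ` A \<Longrightarrow> card {x \<in> A. f x = y} = n"
  shows "card A = card (f ` A) * n"
proof -
  have "card A = (\<Sum>y\<in>f ` A. card {x \<in> A. f x = y})"
    using sum.image_gen[OF assms(1), of "\<lambda>_. 1::nat" f] by simp
  then show ?thesis using assms(2) by simp
qed

context group
begin

lemma card_subgroup_dvd:
  assumes "subgroup A G" "subgroup B G" "A \<subseteq> B"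
  shows "card A dvd card B"
proof -
  interpret B: group "G\<lparr>carrier := B\<rparr>"
    using assms(2) by (rule subgroup_imp_group)
  have "subgroup A (G\<lparr>carrier := B\<rparr>)"
    using assms by (simp add: subgroup_incl)
  from B.lagrange[OF this] have "card (rcosets\<^bsub>G\<lparr>carrier := B\<rparr>\<^esub> A) * card A = card B"
    by (simp add: order_def)
  then show ?thesis by (metis dvd_triv_right)
qed

lemma card_subgroup_pos:
  assumes "finite (carrier G)" "subgroup A G"
  shows "card A > 0"
  using assms by (metis card_gt_0_iff empty_iff finite_subset subgroup.one_closed subgroup.subset)

text \<open>Lagrange twice writes the prime p as a product of the indices of \<open>A\<close> in
  \<open>M\<close> and of \<open>M\<close> in \<open>B\<close>, so one of them is 1. Most of the
  case distinctions below rest on this dichotomy.\<close>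

lemma subgroup_between_prime_index:
  assumes fin: "finite (carrier G)"
    and A: "subgroup A G" and M: "subgroup M G" and B: "subgroup B G"
    and sub: "A \<subseteq> M" "M \<subseteq> B"
    and p: "prime (p::nat)" "card B = p * card A"
  shows "M = A \<or> M = B"
proof -
  have "finite B" "finite M"
    using fin B M by (auto intro: finite_subset dest: subgroup.subset)
  obtain k where k: "card M = card A * k"
    using card_subgroup_dvd[OF A M sub(1)] by (auto elim: dvdE)
  obtain j where j: "card B = card M * j"
    using card_subgroup_dvd[OF M B sub(2)] by (auto elim: dvdE)
  have "card A > 0" using card_subgroup_pos[OF fin A] .
  then have "p = k * j" using k j p(2) by simp
  then have "k = 1 \<or> j = 1" using p(1) by (metis prime_product)
  then show ?thesis
    using k j sub \<open>finite B\<close> \<open>finite M\<close> by (metis card_subset_eq mult.right_neutral)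
qed

text \<open>The fibre of multiplication over hk consists of the pairs (hd, d^-1 k) with d in
  \<open>H \<inter> K\<close>, so all fibres have the same size.\<close>

lemma card_set_mult_subgroups:
  assumes fin: "finite (carrier G)" and H: "subgroup H G" and K: "subgroup K G"
  shows "card (H <#> K) * card (H \<inter> K) = card H * card K"
proof -
  interpret H: subgroup H G by fact
  interpret K: subgroup K G by fact
  have finHK: "finite H" "finite K"
    using fin H.subset K.subset by (auto intro: finite_subset)
  have im: "(\<lambda>(h, k). h \<otimes> k) ` (H \<times> K) = H <#> K"
    by (auto simp: set_mult_def)
  have "card (H \<times> K) = card ((\<lambda>(h, k). h \<otimes> k) ` (H \<times> K)) * card (H \<inter> K)"
  proof (rule card_eq_card_image_mult)
    show "finite (H \<times> K)" using finHK by simp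
    fix y assume "y \<in> (\<lambda>(h, k). h \<otimes> k) ` (H \<times> K)"
    then obtain h k where hk: "h \<in> H" "k \<in> K" "y = h \<otimes> k" by auto
    note [simp] = H.mem_carrier K.mem_carrier
    have "bij_betw (\<lambda>d. (h \<otimes> d, inv d \<otimes> k)) (H \<inter> K) {x \<in> H \<times> K. (case x of (h, k) \<Rightarrow> h \<otimes> k) = y}"
    proof (rule bij_betwI[where g = "\<lambda>(a, b). inv h \<otimes> a"])
      show "(\<lambda>d. (h \<otimes> d, inv d \<otimes> k)) \<in> H \<inter> K \<rightarrow> {x \<in> H \<times> K. (case x of (h, k) \<Rightarrow> h \<otimes> k) = y}"
        using hk by (auto simp: m_assoc inv_solve_left)
          (metis H.mem_carrier K.mem_carrier inv_closed l_one m_assoc m_closed r_inv)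
      have "inv h \<otimes> a \<in> K" if "a \<in> H" "b \<in> K" "a \<otimes> b = h \<otimes> k" for a b
      proof -
        have "inv h \<otimes> a = k \<otimes> inv b"
          using that hk by (metis H.mem_carrier K.mem_carrier inv_closed inv_solve_left inv_solve_right m_assoc m_closed)
        then show ?thesis using that hk by simp
      qed
      then show "(\<lambda>(a, b). inv h \<otimes> a) \<in> {x \<in> H \<times> K. (case x of (h, k) \<Rightarrow> h \<otimes> k) = y} \<rightarrow> H \<inter> K"
        using hk by auto
      show "(\<lambda>(a, b). inv h \<otimes> a) (h \<otimes> d, inv d \<otimes> k) = d" if "d \<in> H \<inter> K" for d
        using that hk by (auto simp flip: m_assoc)
      show "(h \<otimes> (\<lambda>(a, b). inv h \<otimes> a) x, inv ((\<lambda>(a, b). inv h \<otimes> a) x) \<otimes> k) = x"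
        if x: "x \<in> {x \<in> H \<times> K. (case x of (h, k) \<Rightarrow> h \<otimes> k) = y}" for x
      proof -
        obtain a b where ab: "x = (a, b)" "a \<in> H" "b \<in> K" "a \<otimes> b = h \<otimes> k"
          using x hk(3) by auto
        have "inv a \<otimes> (h \<otimes> k) = b" using ab by (simp flip: ab(4) m_assoc)
        then show ?thesis using ab hk by (simp add: inv_mult_group m_assoc) (simp flip: m_assoc)
      qed
    qed
    then show "card {x \<in> H \<times> K. (case x of (h, k) \<Rightarrow> h \<otimes> k) = y} = card (H \<inter> K)"
      by (simp add: bij_betw_same_card)
  qed
  then show ?thesis by (simp add: im card_cartesian_product)
qed

text \<open>A nontrivial element generates a subgroup between the trivial one and the whole group,
  hence the whole group.\<close>

lemma prime_order_imp_cyclic_group: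
  assumes "prime (order G)"
  shows "cyclic_group G"
proof -
  have fin: "finite (carrier G)"
    using prime_gt_0_nat[OF assms] by (simp add: order_gt_0_iff_finite)
  have "order G > 1" using assms by (rule prime_gt_1_nat)
  then obtain x where x: "x \<in> carrier G" "x \<noteq> \<one>"
    using card_mono[of "{\<one>}" "carrier G"] unfolding order_def by force
  have gen: "subgroup (generate G {x}) G" using x by (simp add: generate_is_subgroup)
  then have "generate G {x} = {\<one>} \<or> generate G {x} = carrier G"
    using subgroup_between_prime_index[OF fin triv_subgroup gen subgroup_self _ _ assms]
      subgroup.one_closed[OF gen] subgroup.subset[OF gen] by (simp add: order_def)
  moreover have "x \<in> generate G {x}" by (simp add: generate.incl)
  ultimately have "carrier G = generate G {x}" using x by auto
  then show ?thesis
    unfolding cyclic_group using x(1) generate_pow[OF x(1)] by (intro bexI[of _ x]) (simp_all add: full_SetCompr_eq)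
qed

end

section \<open>Supersolubility as reachability by steps of prime index\<close>

text \<open>Recasts one link of the series by cardinalities: groups of prime order are cyclic, so
  the factor group need not appear. The series then becomes a path of a relation, open to
  induction.\<close>

definition prime_step :: "('a, 'b) monoid_scheme \<Rightarrow> 'a set \<Rightarrow> 'a set \<Rightarrow> bool" where
  "prime_step G A B \<longleftrightarrow> A \<lhd> G \<and> B \<lhd> G \<and> A \<subseteq> B \<and> (\<exists>p::nat. prime p \<and> card B = p * card A)"

lemma (in group) prime_step_iff_factor:
  assumes "finite (carrier G)" "A \<lhd> G" "B \<lhd> G" "A \<subseteq> B"
  shows "prime_step G A B \<longleftrightarrow>
    cyclic_group ((G\<lparr>carrier := B\<rparr>) Mod A) \<and> prime (order ((G\<lparr>carrier := B\<rparr>) Mod A))"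
proof -
  have sg: "subgroup A G" "subgroup B G" using assms by (auto dest: normal_imp_subgroup)
  interpret B: group "G\<lparr>carrier := B\<rparr>"
    using sg(2) by (rule subgroup_imp_group)
  interpret A: normal A "G\<lparr>carrier := B\<rparr>"
    using assms sg by (simp add: normal_restrict_supergroup)
  have "order (G\<lparr>carrier := B\<rparr> Mod A) * card A = card B"
    using B.lagrange[OF A.subgroup_axioms] by (simp add: order_def FactGroup_def)
  moreover have "card A > 0" using assms(1) sg(1) by (rule card_subgroup_pos)
  ultimately have "prime_step G A B \<longleftrightarrow> prime (order (G\<lparr>carrier := B\<rparr> Mod A))"
    using assms unfolding prime_step_def by (metis mult_cancel2 neq0_conv)
  then show ?thesis
    using group.prime_order_imp_cyclic_group[OF A.factorgroup_is_group] by blast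
qed

lemma (in group) supersoluble_iff_prime_steps:
  assumes "finite (carrier G)"
  shows "supersoluble G \<longleftrightarrow> (prime_step G)\<^sup>*\<^sup>* {\<one>} (carrier G)"
proof
  assume "supersoluble G"
  then obtain Hs where Hs: "Hs \<noteq> []" "hd Hs = {\<one>}" "last Hs = carrier G"
    "\<forall>i < length Hs. Hs ! i \<lhd> G"
    "\<forall>i. Suc i < length Hs \<longrightarrow> Hs ! i \<subseteq> Hs ! Suc i \<and>
       cyclic_group ((G\<lparr>carrier := Hs ! Suc i\<rparr>) Mod (Hs ! i)) \<and>
       prime (order ((G\<lparr>carrier := Hs ! Suc i\<rparr>) Mod (Hs ! i)))"
    unfolding supersoluble_def by blast
  \<comment> \<open>A series with n members has n - 1 links; the list itself, read by
    \<open>nth\<close>, is the witnessing path.\<close>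
  have "(prime_step G ^^ (length Hs - 1)) (Hs ! 0) (Hs ! (length Hs - 1))"
    unfolding relpowp_fun_conv
    by (intro exI[of _ "nth Hs"] conjI allI impI) (use Hs in \<open>simp_all add: prime_step_iff_factor[OF assms]\<close>)
  then show "(prime_step G)\<^sup>*\<^sup>* {\<one>} (carrier G)"
    using Hs(1-3) by (metis hd_conv_nth last_conv_nth relpowp_imp_rtranclp)
next
  assume "(prime_step G)\<^sup>*\<^sup>* {\<one>} (carrier G)"
  then obtain n f where f: "f 0 = {\<one>}" "f n = carrier G" "\<forall>i<n. prime_step G (f i) (f (Suc i))"
    by (metis relpowp_fun_conv rtranclp_imp_relpowp)
  have normal: "f i \<lhd> G" if "i \<le> n" for i
  proof (cases "i = n")
    case True
    then show ?thesis using f(2) normal_self by simp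
  next
    case False
    then show ?thesis using f(3) that by (simp add: prime_step_def)
  qed
  have "hd (map f [0..<Suc n]) = {\<one>}" using f(1) by (simp add: hd_map del: upt_Suc)
  moreover have "last (map f [0..<Suc n]) = carrier G" using f(2) by simp
  moreover have "map f [0..<Suc n] ! i = f i" if "i \<le> n" for i
    using that by (simp del: upt_Suc)
  moreover have "f i \<subseteq> f (Suc i) \<and>
       cyclic_group ((G\<lparr>carrier := f (Suc i)\<rparr>) Mod (f i)) \<and>
       prime (order ((G\<lparr>carrier := f (Suc i)\<rparr>) Mod (f i)))" if "i < n" for i
    using f(3) that prime_step_iff_factor[OF assms] unfolding prime_step_def by blast
  ultimately show "supersoluble G"
    unfolding supersoluble_def
    by (intro exI[of _ "map f [0..<Suc n]"] conjI allI impI) (simp_all add: normal del: upt_Suc)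
qed

text \<open>The second alternative is there because intersecting with a subgroup or applying a
  homomorphism may identify neighbouring members of a series.\<close>

lemma prime_steps_map:
  assumes "(prime_step G)\<^sup>*\<^sup>* A B"
    and "\<And>A B. prime_step G A B \<Longrightarrow> prime_step G' (f A) (f B) \<or> f A = f B"
  shows "(prime_step G')\<^sup>*\<^sup>* (f A) (f B)"
  using assms(1)
proof induction
  case (step B C)
  then show ?case using assms(2)[of B C] by (metis rtranclp.rtrancl_into_rtrancl)
qed simp

section \<open>Subgroups, images, extensions and normal subgroups of supersoluble groups\<close>

text \<open>Intersect the series with \<open>H\<close>. For a step from A to B, the subgroup A(B
  \<inter> H) is A or B: in the first case the intersections coincide, in the second the index p
  survives.\<close>

lemma (in group) supersoluble_subgroup:
  assumes fin: "finite (carrier G)" and ss: "supersoluble G" and H: "subgroup H G"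
  shows "supersoluble (G\<lparr>carrier := H\<rparr>)"
proof -
  interpret H: subgroup H G by fact
  interpret GH: group "G\<lparr>carrier := H\<rparr>"
    using H by (rule subgroup_imp_group)
  have finH: "finite (carrier (G\<lparr>carrier := H\<rparr>))"
    using fin H.subset by (simp add: finite_subset)
  have step: "prime_step (G\<lparr>carrier := H\<rparr>) (A \<inter> H) (B \<inter> H) \<or> A \<inter> H = B \<inter> H"
    if AB: "prime_step G A B" for A B
  proof -
    have A: "A \<lhd> G" and B: "B \<lhd> G" and sub: "A \<subseteq> B" using AB by (auto simp: prime_step_def)
    obtain p :: nat where p: "prime p" "card B = p * card A" using AB by (auto simp: prime_step_def)
    note sA = normal_imp_subgroup[OF A] and sB = normal_imp_subgroup[OF B]
    have sBH: "subgroup (B \<inter> H) G" using sB H by (rule subgroups_Inter_pair)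
    let ?M = "A <#> (B \<inter> H)"
    have M: "subgroup ?M G" using A sBH by (rule mult_norm_subgroup)
    have AM: "A \<subseteq> ?M"
      using subgroup.one_closed[OF sBH] subgroup.subset[OF sA] unfolding set_mult_def by force
    have HM: "B \<inter> H \<subseteq> ?M"
      using subgroup.one_closed[OF sA] subgroup.subset[OF sBH] unfolding set_mult_def by force
    have MB: "?M \<subseteq> B"
      using sub subgroup.m_closed[OF sB] unfolding set_mult_def by auto
    from subgroup_between_prime_index[OF fin sA M sB AM MB p] show ?thesis
    proof
      assume "?M = A"
      then show ?thesis using HM sub by auto
    next
      assume "?M = B"
      \<comment> \<open>The product formula for A and B \<inter> H, whose intersection is A \<inter>
        H because A lies in B.\<close>
      then have "card B * card (A \<inter> H) = card A * card (B \<inter> H)"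
        using card_set_mult_subgroups[OF fin sA sBH] sub
        by (metis Int_absorb1 inf_assoc inf_commute)
      then have "card (B \<inter> H) = p * card (A \<inter> H)"
        using p(2) card_subgroup_pos[OF fin sA] by auto
      moreover have "A \<inter> H \<lhd> G\<lparr>carrier := H\<rparr>" "B \<inter> H \<lhd> G\<lparr>carrier := H\<rparr>"
        using normal_Int_subgroup[OF H] A B by auto
      ultimately show ?thesis
        using p(1) sub unfolding prime_step_def by blast
    qed
  qed
  have "(prime_step (G\<lparr>carrier := H\<rparr>))\<^sup>*\<^sup>* ({\<one>} \<inter> H) (carrier G \<inter> H)"
    using ss step unfolding supersoluble_iff_prime_steps[OF fin]
    by (rule prime_steps_map[where f = "\<lambda>A. A \<inter> H"])
  then show ?thesis
    using H.subset GH.supersoluble_iff_prime_steps[OF finH] by (simp add: Int_absorb1)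
qed

context group_hom
begin

text \<open>The fibres of \<open>h\<close> on \<open>A\<close> are the cosets of
  \<open>A \<inter> kernel G H h\<close>.\<close>

lemma card_image_mult_kernel:
  assumes fin: "finite (carrier G)" and A: "subgroup A G"
  shows "card A = card (h ` A) * card (A \<inter> kernel G H h)"
proof (rule card_eq_card_image_mult)
  interpret A: subgroup A G by fact
  show "finite A" using fin A.subset by (rule finite_subset[rotated])
  fix y assume "y \<in> h ` A"
  then obtain a where a: "a \<in> A" "y = h a" by auto
  have "bij_betw (\<lambda>k. a \<otimes> k) (A \<inter> kernel G H h) {x \<in> A. h x = y}"
    by (rule bij_betwI[where g = "\<lambda>x. inv a \<otimes> x"])
      (use a in \<open>auto simp: kernel_def simp flip: G.m_assoc\<close>)
  then show "card {x \<in> A. h x = y} = card (A \<inter> kernel G H h)"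
    by (simp add: bij_betw_same_card)
qed

lemma subgroup_vimage:
  assumes "subgroup A H"
  shows "subgroup {x \<in> carrier G. h x \<in> A} G"
proof -
  interpret A: subgroup A H by fact
  show ?thesis by unfold_locales auto
qed

lemma normal_vimage:
  assumes "A \<lhd> H"
  shows "{x \<in> carrier G. h x \<in> A} \<lhd> G"
  using assms by (auto simp: G.normal_inv_iff H.normal_inv_iff subgroup_vimage)

lemma card_vimage:
  assumes "finite (carrier G)" "h ` carrier G = carrier H" "subgroup A H"
  shows "card {x \<in> carrier G. h x \<in> A} = card A * card (kernel G H h)"
proof -
  have "h ` {x \<in> carrier G. h x \<in> A} = A"
    using assms(2) subgroup.subset[OF assms(3)] by auto
  moreover have "{x \<in> carrier G. h x \<in> A} \<inter> kernel G H h = kernel G H h"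
    using subgroup.one_closed[OF assms(3)] by (auto simp: kernel_def)
  ultimately show ?thesis
    using card_image_mult_kernel[OF assms(1) subgroup_vimage[OF assms(3)]] by simp
qed

lemma normal_image:
  assumes "h ` carrier G = carrier H" "A \<lhd> G"
  shows "h ` A \<lhd> H"
proof -
  interpret A: normal A G by fact
  have "subgroup (h ` A) H" by (rule subgroup_img_is_subgroup) (rule A.subgroup_axioms)
  moreover have "y \<otimes>\<^bsub>H\<^esub> z \<otimes>\<^bsub>H\<^esub> inv\<^bsub>H\<^esub> y \<in> h ` A" if yz: "y \<in> carrier H" "z \<in> h ` A" for y z
  proof -
    obtain x a where xa: "x \<in> carrier G" "y = h x" "a \<in> A" "z = h a"
      using yz assms(1) by blast
    then have "y \<otimes>\<^bsub>H\<^esub> z \<otimes>\<^bsub>H\<^esub> inv\<^bsub>H\<^esub> y = h (x \<otimes> a \<otimes> inv x)" by simp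
    then show ?thesis using xa A.inv_op_closed2 by blast
  qed
  ultimately show ?thesis by (simp add: H.normal_inv_iff)
qed

text \<open>Push the series forward. With K the kernel, A(B \<inter> K) is A or B; in the second
  case B and A have the same image.\<close>

lemma supersoluble_image:
  assumes fin: "finite (carrier G)" and surj: "h ` carrier G = carrier H" and ss: "supersoluble G"
  shows "supersoluble H"
proof -
  let ?K = "kernel G H h"
  have finH: "finite (carrier H)" using fin surj by (metis finite_imageI)
  have step: "prime_step H (h ` A) (h ` B) \<or> h ` A = h ` B"
    if AB: "prime_step G A B" for A B
  proof -
    have A: "A \<lhd> G" and B: "B \<lhd> G" and sub: "A \<subseteq> B" using AB by (auto simp: prime_step_def)
    obtain p :: nat where p: "prime p" "card B = p * card A" using AB by (auto simp: prime_step_def)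
    note sA = normal_imp_subgroup[OF A] and sB = normal_imp_subgroup[OF B]
    have sBK: "subgroup (B \<inter> ?K) G" using sB subgroup_kernel by (rule G.subgroups_Inter_pair)
    let ?M = "A <#> (B \<inter> ?K)"
    have M: "subgroup ?M G" using A sBK by (rule G.mult_norm_subgroup)
    have AM: "A \<subseteq> ?M"
      using subgroup.one_closed[OF sBK] subgroup.subset[OF sA] unfolding set_mult_def by force
    have KM: "B \<inter> ?K \<subseteq> ?M"
      using subgroup.one_closed[OF sA] subgroup.subset[OF sBK] unfolding set_mult_def by force
    have MB: "?M \<subseteq> B"
      using sub subgroup.m_closed[OF sB] unfolding set_mult_def by auto
    from G.subgroup_between_prime_index[OF fin sA M sB AM MB p] show ?thesis
    proof
      assume M: "?M = A"
      \<comment> \<open>Here B \<inter> K lies in A, so A and B meet the kernel in the same subgroup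
        and the index of A in B passes to the images.\<close>
      have "card (h ` B) * card (B \<inter> ?K) = p * card (h ` A) * card (B \<inter> ?K)"
        using card_image_mult_kernel[OF fin sA] card_image_mult_kernel[OF fin sB] p(2) KM M sub
        by (metis Int_absorb1 Int_assoc Int_left_absorb inf_commute le_inf_iff mult.assoc subset_antisym inf_le2)
      then have "card (h ` B) = p * card (h ` A)"
        using G.card_subgroup_pos[OF fin sBK] by simp
      then show ?thesis
        using p(1) sub normal_image[OF surj] A B unfolding prime_step_def by blast
    next
      assume M: "?M = B"
      have "h x \<in> h ` A" if "x \<in> ?M" for x
      proof -
        from that obtain a k where "a \<in> A" "k \<in> ?K" "k \<in> B" "x = a \<otimes> k"
          unfolding set_mult_def by auto
        then show ?thesis using subgroup.mem_carrier[OF sA] by (auto simp: kernel_def)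
      qed
      then show ?thesis using M sub by auto
    qed
  qed
  have "(prime_step H)\<^sup>*\<^sup>* (h ` {\<one>}) (h ` carrier G)"
    using ss step unfolding G.supersoluble_iff_prime_steps[OF fin]
    by (rule prime_steps_map[where f = "\<lambda>A. h ` A"])
  then show ?thesis
    using surj H.supersoluble_iff_prime_steps[OF finH] by simp
qed

text \<open>Preimages multiply all cardinalities by that of the kernel, so the indices are kept. The
  pulled-back series begins at the kernel, and its prime order supplies the missing bottom
  step.\<close>

lemma supersoluble_extension:
  assumes fin: "finite (carrier G)" and surj: "h ` carrier G = carrier H"
    and p: "prime (card (kernel G H h))" and ss: "supersoluble H"
  shows "supersoluble G"
proof -
  let ?K = "kernel G H h"
  have finH: "finite (carrier H)" using fin surj by (metis finite_imageI)
  let ?f = "\<lambda>A. {x \<in> carrier G. h x \<in> A}"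
  have step: "prime_step G (?f A) (?f B)" if AB: "prime_step H A B" for A B
  proof -
    have A: "A \<lhd> H" and B: "B \<lhd> H" and sub: "A \<subseteq> B" using AB by (auto simp: prime_step_def)
    obtain q :: nat where q: "prime q" "card B = q * card A" using AB by (auto simp: prime_step_def)
    have "card (?f B) = q * card (?f A)"
      using card_vimage[OF fin surj] A B q(2) by (simp add: normal_imp_subgroup)
    then show ?thesis
      using q(1) sub normal_vimage A B unfolding prime_step_def by blast
  qed
  have "(prime_step G)\<^sup>*\<^sup>* (?f {\<one>\<^bsub>H\<^esub>}) (?f (carrier H))"
    using ss disjI1[OF step] unfolding H.supersoluble_iff_prime_steps[OF finH]
    by (rule prime_steps_map[where f = ?f])
  moreover have "?f {\<one>\<^bsub>H\<^esub>} = ?K" "?f (carrier H) = carrier G" by (auto simp: kernel_def)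
  moreover have "prime_step G {\<one>} ?K"
    using p G.one_is_normal normal_kernel subgroup.one_closed[OF subgroup_kernel]
    unfolding prime_step_def by auto
  ultimately show ?thesis
    using G.supersoluble_iff_prime_steps[OF fin] by (metis converse_rtranclp_into_rtranclp)
qed

end

text \<open>Let B, C be the step of the series at which the intersection with \<open>N\<close> stops
  being trivial. Then \<open>N \<inter> C\<close> meets B trivially, so its order divides the prime
  index of B in C.\<close>

lemma (in group) normal_prime_subgroup_of_supersoluble:
  assumes fin: "finite (carrier G)" and ss: "supersoluble G"
    and N: "N \<lhd> G" "N \<noteq> {\<one>}"
  shows "\<exists>L. L \<lhd> G \<and> L \<subseteq> N \<and> prime (card L)"
proof -
  \<comment> \<open>Invariant along the series: either \<open>N\<close> has not been met yet, or the
    crossing step has been found. At the top only the latter is possible.\<close>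
  have "N \<inter> A = {\<one>} \<or> (\<exists>B C. prime_step G B C \<and> N \<inter> B = {\<one>} \<and> N \<inter> C \<noteq> {\<one>})"
    if "(prime_step G)\<^sup>*\<^sup>* {\<one>} A" for A
    using that
  proof induction
    case base
    then show ?case using N(1) by (auto dest: normal_imp_subgroup subgroup.one_closed)
  next
    case (step B C)
    then show ?case by blast
  qed
  from this[of "carrier G"] obtain B C
    where BC: "prime_step G B C" "N \<inter> B = {\<one>}" "N \<inter> C \<noteq> {\<one>}"
    using ss N subgroup.subset[OF normal_imp_subgroup[OF N(1)]]
    by (auto simp: supersoluble_iff_prime_steps[OF fin] Int_absorb2)
  obtain p :: nat where p: "prime p" "card C = p * card B" using BC(1) by (auto simp: prime_step_def)
  have B: "B \<lhd> G" and C: "C \<lhd> G" and sub: "B \<subseteq> C" using BC(1) by (auto simp: prime_step_def)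
  have NC: "N \<inter> C \<lhd> G" using N(1) C by (rule normal_subgroup_intersect)
  note sB = normal_imp_subgroup[OF B] and sNC = normal_imp_subgroup[OF NC] and sC = normal_imp_subgroup[OF C]
  have "card (B <#> (N \<inter> C)) * card (B \<inter> (N \<inter> C)) = card B * card (N \<inter> C)"
    by (rule card_set_mult_subgroups[OF fin sB sNC])
  moreover have "B \<inter> (N \<inter> C) = {\<one>}" using BC(2) sub by blast
  ultimately have "card (B <#> (N \<inter> C)) = card B * card (N \<inter> C)" by simp
  moreover have "card (B <#> (N \<inter> C)) dvd card C"
  proof (rule card_subgroup_dvd)
    show "subgroup (B <#> (N \<inter> C)) G" using B sNC by (rule mult_norm_subgroup)
    show "B <#> (N \<inter> C) \<subseteq> C"
      using sub subgroup.m_closed[OF sC] unfolding set_mult_def by auto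
  qed (rule sC)
  ultimately have "card (N \<inter> C) dvd p"
    using p(2) card_subgroup_pos[OF fin sB] by (simp add: mult.commute)
  moreover have "card (N \<inter> C) \<noteq> 1"
    using BC(3) subgroup.one_closed[OF sNC] by (metis card_1_singletonE singletonD)
  ultimately have "card (N \<inter> C) = p" using p(1) by (meson prime_nat_iff)
  then show ?thesis using p(1) NC by blast
qed

text \<open>Representing the cosets by elements keeps the quotient on the type of the group itself, so
  that one can argue by induction on the order.\<close>

lemma (in group) quotient_on_same_type:
  assumes N: "N \<lhd> G"
  obtains Q :: "('a, 'b) monoid_scheme" and h where
    "group_hom G Q h" "h ` carrier G = carrier Q" "kernel G Q h = N"
proof -
  interpret N: normal N G by fact
  define h where "h x = (SOME y. y \<in> N #> x)" for x
  define Q where "Q = G\<lparr>carrier := h ` carrier G, mult := \<lambda>x y. h (x \<otimes> y), one := h \<one>\<rparr>"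
  have h_mem: "h x \<in> N #> x" if "x \<in> carrier G" for x
    unfolding h_def using rcos_self[OF that N.subgroup_axioms] by (rule someI)
  have h_closed: "h x \<in> carrier G" if "x \<in> carrier G" for x
    using h_mem[OF that] that by (metis N.subset r_coset_subset_G subsetD)
  have h_coset: "N #> h x = N #> x" if "x \<in> carrier G" for x
    using repr_independence[OF h_mem[OF that] that N.subgroup_axioms] by simp
  have h_eqI: "h x = h y" if "N #> x = N #> y" for x y
    unfolding h_def that ..
  have h_mult: "h (h x \<otimes> h y) = h (x \<otimes> y)" if "x \<in> carrier G" "y \<in> carrier G" for x y
    using that by (intro h_eqI) (metis N.rcos_sum h_closed h_coset)
  have h_l: "h (h x \<otimes> y) = h (x \<otimes> y)" and h_r: "h (x \<otimes> h y) = h (x \<otimes> y)"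
    if "x \<in> carrier G" "y \<in> carrier G" for x y
    using that by (auto intro!: h_eqI) (metis N.rcos_sum h_closed h_coset)+
  have "group Q"
  proof (rule groupI)
    show "x \<otimes>\<^bsub>Q\<^esub> y \<otimes>\<^bsub>Q\<^esub> z = x \<otimes>\<^bsub>Q\<^esub> (y \<otimes>\<^bsub>Q\<^esub> z)"
      if "x \<in> carrier Q" "y \<in> carrier Q" "z \<in> carrier Q" for x y z
    proof -
      have "x \<in> carrier G" "y \<in> carrier G" "z \<in> carrier G" using that h_closed by (auto simp: Q_def)
      then show ?thesis by (simp add: Q_def h_l h_r m_assoc)
    qed
    show "\<exists>y\<in>carrier Q. y \<otimes>\<^bsub>Q\<^esub> x = \<one>\<^bsub>Q\<^esub>" if "x \<in> carrier Q" for x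
    proof -
      from that obtain a where a: "a \<in> carrier G" "x = h a" by (auto simp: Q_def)
      then show ?thesis by (intro bexI[of _ "h (inv a)"]) (auto simp: Q_def h_mult)
    qed
  next
    show "\<one>\<^bsub>Q\<^esub> \<otimes>\<^bsub>Q\<^esub> x = x" if x: "x \<in> carrier Q" for x
    proof -
      obtain a where "a \<in> carrier G" "x = h a" using x by (auto simp: Q_def)
      then show ?thesis by (simp add: Q_def h_mult)
    qed
  qed (auto simp: Q_def h_closed)
  moreover have "h \<in> hom G Q" by (auto simp: hom_def Q_def h_mult)
  ultimately have hom: "group_hom G Q h" by (simp add: group_hom_def group_hom_axioms_def is_group)
  have "h x = h \<one> \<longleftrightarrow> x \<in> N" if x: "x \<in> carrier G" for x
  proof -
    have "h x = h \<one> \<longleftrightarrow> N #> x = N #> \<one>"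
      using h_eqI h_coset x by (metis one_closed)
    also have "\<dots> \<longleftrightarrow> x \<in> N"
      using x N.subgroup_axioms N.subset by (metis coset_join1 coset_join2 coset_mult_one)
    finally show ?thesis .
  qed
  then have "kernel G Q h = N" using N.subset by (auto simp: kernel_def Q_def)
  moreover have "h ` carrier G = carrier Q" by (simp add: Q_def)
  ultimately show ?thesis using hom that by blast
qed

section \<open>Group actions, fixed points and criteria for normality\<close>

text \<open>The restriction to \<open>E\<close> is forced by \<open>Bij\<close>, whose members are
  extensional; the action of the inverse element provides bijectivity.\<close>

lemma group_actionI:
  assumes "group G"
    and closed: "\<And>g x. g \<in> carrier G \<Longrightarrow> x \<in> E \<Longrightarrow> f g x \<in> E"
    and one: "\<And>x. x \<in> E \<Longrightarrow> f \<one>\<^bsub>G\<^esub> x = x"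
    and mult: "\<And>g h x. g \<in> carrier G \<Longrightarrow> h \<in> carrier G \<Longrightarrow> x \<in> E \<Longrightarrow> f (g \<otimes>\<^bsub>G\<^esub> h) x = f g (f h x)"
  shows "group_action G E (\<lambda>g. restrict (f g) E)"
proof -
  interpret group G by fact
  have Bij: "restrict (f g) E \<in> Bij E" if g: "g \<in> carrier G" for g
  proof -
    have "bij_betw (restrict (f g) E) E E"
      by (rule bij_betwI[where g = "f (inv\<^bsub>G\<^esub> g)"])
        (use g in \<open>auto simp: closed one simp flip: mult\<close>)
    then show ?thesis by (simp add: Bij_def)
  qed
  have "(\<lambda>g. restrict (f g) E) \<in> hom G (BijGroup E)"
    by (rule homI) (auto simp: BijGroup_def Bij compose_def mult closed intro!: ext)
  then show ?thesis
    by (simp add: group_action_def group_hom_def group_hom_axioms_def group_BijGroup is_group)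
qed

lemma (in group_action) card_orbit_dvd_order:
  assumes "x \<in> E"
  shows "card (orbit G \<phi> x) dvd order G"
  using orbit_stabilizer_theorem[OF assms] by (metis dvd_triv_left)

lemma (in group_action) fixed_if_card_orbit_le_1:
  assumes "finite (carrier G)" "x \<in> E" "card (orbit G \<phi> x) \<le> 1" "g \<in> carrier G"
  shows "\<phi> g x = x"
proof -
  have "finite (orbit G \<phi> x)" using assms(1) by (simp add: orbit_def)
  moreover have "\<phi> g x \<in> orbit G \<phi> x" using assms(4) by (auto simp: orbit_def)
  ultimately show ?thesis
    using orbit_refl[OF assms(2)] assms(3) card_le_Suc0_iff_eq[of "orbit G \<phi> x"] by auto
qed

text \<open>Orbit sizes are powers of p and sum up to \<open>card E\<close>; one that is not
  divisible by p must be 1.\<close>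

lemma (in group_action) prime_power_group_has_fixed_point:
  assumes p: "prime (p::nat)" and order: "order G = p ^ a"
    and "finite E" and ndvd: "\<not> p dvd card E"
  obtains x where "x \<in> E" "\<And>g. g \<in> carrier G \<Longrightarrow> \<phi> g x = x"
proof -
  interpret G: group G using group_hom by (simp add: group_hom_def)
  have fin: "finite (carrier G)"
    using order p by (metis G.order_gt_0_iff_finite prime_gt_0_nat zero_less_power)
  have "card E = (\<Sum>orb\<in>orbits G E \<phi>. card orb)"
    using disjoint_sum[OF \<open>finite E\<close>, of "\<lambda>_. 1::nat"] by simp
  then obtain orb where "orb \<in> orbits G E \<phi>" "\<not> p dvd card orb"
    using ndvd by (metis dvd_sum)
  then obtain x where x: "x \<in> E" "\<not> p dvd card (orbit G \<phi> x)"
    unfolding orbits_def by blast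
  moreover obtain i where "card (orbit G \<phi> x) = p ^ i"
    using card_orbit_dvd_order[OF x(1)] order divides_primepow_nat[OF p] by auto
  ultimately have "card (orbit G \<phi> x) = 1" by (cases i) auto
  then show ?thesis using that x(1) fixed_if_card_orbit_le_1[OF fin x(1)] by simp
qed

context group
begin

text \<open>Multiplying by the inverse turns right multiplication into a left action.\<close>

lemma rcosets_action:
  assumes R: "subgroup R G" and P: "subgroup P G"
  shows "group_action (G\<lparr>carrier := P\<rparr>) (rcosets R) (\<lambda>g. \<lambda>C\<in>rcosets R. C #> inv g)"
proof (rule group_actionI)
  interpret R: subgroup R G by fact
  interpret P: subgroup P G by fact
  show "group (G\<lparr>carrier := P\<rparr>)" using P by (rule subgroup_imp_group)
  show "C #> inv g \<in> rcosets R" if "g \<in> carrier (G\<lparr>carrier := P\<rparr>)" "C \<in> rcosets R" for g C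
    using that R.subset by (auto simp: RCOSETS_def coset_mult_assoc)
  show "C #> inv \<one>\<^bsub>G\<lparr>carrier := P\<rparr>\<^esub> = C" if "C \<in> rcosets R" for C
    using that R.subset by (auto simp: RCOSETS_def coset_mult_assoc)
  show "C #> inv (g \<otimes>\<^bsub>G\<lparr>carrier := P\<rparr>\<^esub> h) = C #> inv h #> inv g"
    if "g \<in> carrier (G\<lparr>carrier := P\<rparr>)" "h \<in> carrier (G\<lparr>carrier := P\<rparr>)" "C \<in> rcosets R" for g h C
    using that R.subset by (auto simp: RCOSETS_def coset_mult_assoc inv_mult_group m_assoc)
qed

lemma coset_fixed_imp_conj_mem:
  assumes R: "subgroup R G" and xy: "x \<in> carrier G" "y \<in> carrier G" and eq: "R #> x #> inv y = R #> x"
  shows "x \<otimes> y \<otimes> inv x \<in> R"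
proof -
  interpret R: subgroup R G by fact
  have "R #> x #> y = R #> x"
    using xy R.subset by (subst eq[symmetric]) (simp add: coset_mult_assoc m_assoc)
  then have "R #> (x \<otimes> y \<otimes> inv x) = R"
    using xy R.subset by (metis coset_mult_assoc coset_mult_one inv_closed m_closed r_inv)
  then show ?thesis using xy R by (intro coset_join1[of R]) auto
qed

text \<open>The conjugacy part of Sylow's theorem: \<open>P\<close> acts on the cosets of
  \<open>R\<close>, and a fixed coset Rx gives x P x^-1 \<subseteq> R.\<close>

lemma prime_power_subgroup_conj_into:
  assumes fin: "finite (carrier G)" and R: "subgroup R G" and P: "subgroup P G"
    and p: "prime (p::nat)" "card P = p ^ a" "\<not> p dvd card (rcosets R)"
  obtains x where "x \<in> carrier G" "\<And>y. y \<in> P \<Longrightarrow> x \<otimes> y \<otimes> inv x \<in> R"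
proof -
  interpret act: group_action "G\<lparr>carrier := P\<rparr>" "rcosets R" "\<lambda>g. \<lambda>C\<in>rcosets R. C #> inv g"
    using R P by (rule rcosets_action)
  have "finite (rcosets R)"
    using fin by (auto simp: RCOSETS_def)
  then obtain C where C: "C \<in> rcosets R" "\<And>y. y \<in> P \<Longrightarrow> C #> inv y = C"
    using act.prime_power_group_has_fixed_point[of p a] p by (auto simp: order_def)
  then obtain x where "x \<in> carrier G" "C = R #> x" by (auto simp: RCOSETS_def)
  then show ?thesis
    using that C coset_fixed_imp_conj_mem[OF R] subgroup.mem_carrier[OF P] by metis
qed

text \<open>The subgroup acts on its cosets fixing one of them, so every orbit is shorter than the index.\<close>

lemma normal_if_index_le_prime_divisors:
  assumes fin: "finite (carrier G)" and H: "subgroup H G"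
    and le: "\<And>q::nat. prime q \<Longrightarrow> q dvd card H \<Longrightarrow> card (rcosets H) \<le> q"
  shows "H \<lhd> G"
proof -
  interpret H: subgroup H G by fact
  let ?\<phi> = "\<lambda>g. \<lambda>C\<in>rcosets H. C #> inv g" and ?H = "G\<lparr>carrier := H\<rparr>"
  interpret act: group_action ?H "rcosets H" ?\<phi>
    using H H by (rule rcosets_action)
  have finR: "finite (rcosets H)" using fin by (auto simp: RCOSETS_def)
  have finH: "finite H" using fin H.subset by (rule finite_subset[rotated])
  have H_mem: "H \<in> rcosets H" using rcosetsI[OF H.subset one_closed] H.subset by simp
  have H_fix: "?\<phi> h H = H" if "h \<in> H" for h
    using that H_mem H.rcos_const by simp
  have fixed: "C #> inv h = C" if C: "C \<in> rcosets H" and h: "h \<in> H" for C h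
  proof (cases "C = H")
    case True
    then show ?thesis using H_fix[OF h] H_mem by simp
  next
    case False
    have "H \<notin> orbit ?H ?\<phi> C"
    proof
      assume "H \<in> orbit ?H ?\<phi> C"
      then have "C \<in> orbit ?H ?\<phi> H" using act.orbit_sym C H_mem by blast
      then show False using H_fix False by (auto simp: orbit_def)
    qed
    moreover have "orbit ?H ?\<phi> C \<subseteq> rcosets H"
      using act.element_image C by (auto simp: orbit_def)
    ultimately have less: "card (orbit ?H ?\<phi> C) < card (rcosets H)"
      using finR H_mem by (intro psubset_card_mono) auto
    have dvd: "card (orbit ?H ?\<phi> C) dvd card H"
      using act.card_orbit_dvd_order[OF C] by (simp add: order_def)
    \<comment> \<open>A larger orbit size would have a prime divisor q; q divides
      \<open>card H\<close>, so it is at least the index, which exceeds the orbit size.\<close>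
    have "card (orbit ?H ?\<phi> C) \<le> 1"
    proof (rule ccontr)
      assume "\<not> card (orbit ?H ?\<phi> C) \<le> 1"
      then obtain q :: nat where q: "prime q" "q dvd card (orbit ?H ?\<phi> C)"
        by (metis prime_factor_nat order_refl)
      then have "card (rcosets H) \<le> q" using le dvd dvd_trans by blast
      moreover have "q \<le> card (orbit ?H ?\<phi> C)"
        using q(2) \<open>\<not> _ \<le> 1\<close> by (intro dvd_imp_le) auto
      ultimately show False using less by simp
    qed
    then show ?thesis
      using act.fixed_if_card_orbit_le_1[OF _ C, of h] finH h C by simp
  qed
  have "x \<otimes> h \<otimes> inv x \<in> H" if "x \<in> carrier G" "h \<in> H" for x h
    using that fixed[OF rcosetsI[OF H.subset that(1)] that(2)]
    by (intro coset_fixed_imp_conj_mem[OF H]) simp_all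
  then show ?thesis using H by (simp add: normal_inv_iff)
qed

text \<open>Conjugation acts on the nontrivial elements, whose number is one less than a multiple of
  p; a fixed point is central.\<close>

lemma prime_power_group_has_central_element:
  assumes p: "prime (p::nat)" and order: "order G = p ^ a" "order G \<noteq> 1"
  obtains z where "z \<in> carrier G" "z \<noteq> \<one>" "\<And>g. g \<in> carrier G \<Longrightarrow> g \<otimes> z = z \<otimes> g"
proof -
  let ?E = "carrier G - {\<one>}"
  have fin: "finite (carrier G)"
    using order(1) p by (metis order_gt_0_iff_finite prime_gt_0_nat zero_less_power)
  interpret act: group_action G ?E "\<lambda>g. \<lambda>x\<in>?E. g \<otimes> x \<otimes> inv g"
  proof (rule group_actionI)
    fix g x assume gx: "g \<in> carrier G" "x \<in> ?E"
    have "x = \<one>" if "g \<otimes> x \<otimes> inv g = \<one>"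
    proof -
      have "x = inv g \<otimes> (g \<otimes> x \<otimes> inv g) \<otimes> g" using gx by (simp add: m_assoc) (simp flip: m_assoc)
      then show ?thesis using that gx by simp
    qed
    then show "g \<otimes> x \<otimes> inv g \<in> ?E" using gx by auto
  qed (auto simp: is_group inv_mult_group m_assoc)
  have "p dvd order G" using order by (cases a) auto
  moreover have "card ?E + 1 = order G" using fin by (simp add: order_def card_Diff_singleton)
      (metis One_nat_def Suc_pred card_gt_0_iff empty_iff one_closed)
  ultimately have "\<not> p dvd card ?E"
    using p by (metis dvd_add_right_iff not_prime_unit)
  then obtain z where z: "z \<in> ?E" "\<And>g. g \<in> carrier G \<Longrightarrow> g \<otimes> z \<otimes> inv g = z"
    using act.prime_power_group_has_fixed_point[OF p order(1)] fin by auto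
  then show ?thesis
    using that by (metis DiffD1 DiffD2 inv_closed inv_solve_right insertI1 m_closed)
qed

text \<open>By coprimality \<open>Q\<close> is the set of all x in \<open>H\<close> with x^|Q| = 1,
  a description that conjugation by any element of \<open>G\<close> preserves.\<close>

lemma normal_if_coprime_in_normal:
  assumes fin: "finite (carrier G)" and H: "H \<lhd> G" and Q: "Q \<lhd> G\<lparr>carrier := H\<rparr>"
    and co: "card H = card Q * m" "coprime (card Q) m"
  shows "Q \<lhd> G"
proof -
  interpret H: normal H G by fact
  let ?H = "G\<lparr>carrier := H\<rparr>"
  interpret GH: group ?H using H.subgroup_axioms by (rule subgroup_imp_group)
  interpret Q: normal Q ?H by fact
  have QH: "Q \<subseteq> H" using Q.subset by simp
  have Q_sub: "subgroup Q G" using Q.subgroup_axioms H.subgroup_axioms by (simp add: incl_subgroup)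
  have finQ: "finite Q" using QH H.subset fin by (meson finite_subset)
  have Q_pos: "card Q > 0" using card_subgroup_pos[OF fin Q_sub] .
  have mod_order: "order (?H Mod Q) = m"
    using GH.lagrange[OF Q.subgroup_axioms] co(1) Q_pos by (simp add: order_def FactGroup_def)
  \<comment> \<open>The order of the coset of x divides both |Q| and the order m of H/Q, so this
    coset is trivial.\<close>
  have mem: "x \<in> Q" if x: "x \<in> H" "x [^] card Q = \<one>" for x
  proof -
    interpret M: group "?H Mod Q" by (rule Q.factorgroup_is_group)
    let ?c = "Q #>\<^bsub>?H\<^esub> x"
    have c: "?c \<in> carrier (?H Mod Q)" using x(1) by (auto simp: FactGroup_def RCOSETS_def)
    have "?c [^]\<^bsub>?H Mod Q\<^esub> card Q = Q #>\<^bsub>?H\<^esub> (x [^]\<^bsub>?H\<^esub> card Q)"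
      using x(1) by (intro Q.FactGroup_pow) simp
    also have "\<dots> = \<one>\<^bsub>?H Mod Q\<^esub>"
      using x Q.subset GH.coset_mult_one[of Q] by (simp add: nat_pow_consistent[symmetric] FactGroup_def)
    finally have "M.ord ?c dvd card Q" using M.pow_eq_id[OF c] by blast
    moreover have "M.ord ?c dvd m"
      using M.ord_dvd_group_order[OF c] mod_order by simp
    ultimately have "M.ord ?c = 1"
      using co(2) by (metis coprime_common_divisor_nat nat_dvd_1_iff_1 coprime_def)
    then have "?c = Q" using c M.ord_eq_1[OF c] by (simp add: FactGroup_def)
    then show ?thesis using x(1) GH.coset_join1[OF _ _ Q.subgroup_axioms] Q.subset by simp
  qed
  have pow: "h [^] card Q = \<one>" if "h \<in> Q" for h
  proof -
    interpret GQ: group "G\<lparr>carrier := Q\<rparr>" using Q_sub by (rule subgroup_imp_group)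
    have "h [^]\<^bsub>G\<lparr>carrier := Q\<rparr>\<^esub> order (G\<lparr>carrier := Q\<rparr>) = \<one>"
      using GQ.pow_order_eq_1[of h] that by simp
    then show ?thesis by (simp add: order_def nat_pow_consistent[symmetric])
  qed
  have conj_pow: "(x \<otimes> h \<otimes> inv x) [^] (n::nat) = x \<otimes> h [^] n \<otimes> inv x"
    if "x \<in> carrier G" "h \<in> carrier G" for x h n
    using that by (induction n) (simp_all add: m_assoc inv_solve_left')
  have "x \<otimes> h \<otimes> inv x \<in> Q" if xh: "x \<in> carrier G" "h \<in> Q" for x h
  proof (rule mem)
    show "x \<otimes> h \<otimes> inv x \<in> H" using xh QH H.inv_op_closed2 by blast
    show "(x \<otimes> h \<otimes> inv x) [^] card Q = \<one>"
      using xh pow QH H.subset by (simp add: conj_pow subsetD)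
  qed
  then show ?thesis using Q_sub by (simp add: normal_inv_iff)
qed

end

section \<open>The normal Sylow subgroup for the largest prime\<close>

lemma (in group_hom) order_eq_mult_card_kernel:
  assumes "finite (carrier G)" "h ` carrier G = carrier H"
  shows "order G = order H * card (kernel G H h)"
  using card_image_mult_kernel[OF assms(1) G.subgroup_self] assms(2)
    subgroup.subset[OF subgroup_kernel] by (simp add: order_def Int_absorb1)

lemma (in group) order_eq_index_mult_card:
  assumes "finite (carrier G)" "subgroup H G"
  shows "order G = n * card H \<longleftrightarrow> card (rcosets H) = n"
  using lagrange[OF assms(2)] card_subgroup_pos[OF assms] by auto

text \<open>Induction through G/L with L normal of prime order. Asking of q only that it bounds the
  primes dividing the order lets the claim pass to quotients of order prime to q, where a =
  0.\<close>

lemma ex_normal_sylow_of_supersoluble: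
  assumes "group G" "finite (carrier G)" "supersoluble G"
    and q: "prime (q::nat)" and max: "\<And>r::nat. prime r \<Longrightarrow> r dvd order G \<Longrightarrow> r \<le> q"
  shows "\<exists>Q a m. Q \<lhd> G \<and> card Q = q ^ a \<and> order G = q ^ a * m \<and> \<not> q dvd m"
  using assms(1-3) max
proof (induction "order G" arbitrary: G rule: less_induct)
  case less
  interpret group G by fact
  note fin = less.prems(2)
  show ?case
  proof (cases "carrier G = {\<one>\<^bsub>G\<^esub>}")
    case True
    then have "order G = 1" by (simp add: order_def)
    then show ?thesis
      using one_is_normal q by (intro exI[of _ "{\<one>\<^bsub>G\<^esub>}"] exI[of _ 0] exI[of _ 1]) auto
  next
    case False
    obtain L where L: "L \<lhd> G" "prime (card L)"
      using normal_prime_subgroup_of_supersoluble[OF fin less.prems(3) normal_self False] by blast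
    obtain G' :: "('a, 'b) monoid_scheme" and h
      where h: "group_hom G G' h" "h ` carrier G = carrier G'" "kernel G G' h = L"
      using quotient_on_same_type[OF L(1)] by blast
    interpret h: group_hom G G' h by fact
    have fin': "finite (carrier G')" using fin h(2) by (metis finite_imageI)
    have order: "order G = order G' * card L"
      using h.order_eq_mult_card_kernel[OF fin h(2)] h(3) by simp
    have "order G' > 0" using fin' by (simp add: h.H.order_gt_0_iff_finite)
    then have "order G' < order G" using order prime_gt_1_nat[OF L(2)] by simp
    then obtain Q' a m where Q': "Q' \<lhd> G'" "card Q' = q ^ a" "order G' = q ^ a * m" "\<not> q dvd m"
      using less.hyps[of G'] h.H.is_group fin' h.supersoluble_image[OF fin h(2) less.prems(3)]
        less.prems(4) order by auto
    define K where "K = {x \<in> carrier G. h x \<in> Q'}"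
    have K: "K \<lhd> G" unfolding K_def using Q'(1) by (rule h.normal_vimage)
    have cardK: "card K = q ^ a * card L"
      unfolding K_def using h.card_vimage[OF fin h(2) normal_imp_subgroup[OF Q'(1)]] Q'(2) h(3) by simp
    show ?thesis
    proof (cases "card L = q")
      case True
      then show ?thesis
        using K cardK order Q'(3,4)
        by (intro exI[of _ K] exI[of _ "Suc a"] exI[of _ m]) auto
    next
      case False
      \<comment> \<open>Now |L| < q, so a Sylow q-subgroup of K has index below q and is normal in
        K; being of coprime index there, it is normal in G.\<close>
      let ?K = "G\<lparr>carrier := K\<rparr>"
      have "card L dvd order G" using order by simp
      then have Lq: "card L < q" using less.prems(4)[OF L(2)] False by simp
      interpret GK: group ?K using normal_imp_subgroup[OF K] by (rule subgroup_imp_group)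
      have finK: "finite K" using fin unfolding K_def by simp
      have orderK: "order ?K = q ^ a * card L" using cardK by (simp add: order_def)
      obtain P where P: "subgroup P ?K" "card P = q ^ a"
        using sylow_thm[OF q GK.is_group orderK] finK by auto
      have "P \<lhd> ?K"
      proof (rule GK.normal_if_index_le_prime_divisors[OF _ P(1)])
        show "finite (carrier ?K)" using finK by simp
        have "card (rcosets\<^bsub>?K\<^esub> P) = card L"
          using GK.order_eq_index_mult_card[OF _ P(1), of "card L"] finK orderK P(2)
          by (simp add: mult.commute)
        then show "card (rcosets\<^bsub>?K\<^esub> P) \<le> r" if "prime r" "r dvd card P" for r
          using that P(2) Lq q by (metis less_imp_le_nat prime_dvd_power primes_dvd_imp_eq)
      qed
      moreover have "coprime (card P) (card L)"
        using P(2) q L(2) False by (simp add: primes_coprime)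
      ultimately have "P \<lhd> G"
        using normal_if_coprime_in_normal[OF fin K _ _] cardK P(2) by metis
      moreover have "\<not> q dvd m * card L"
        using q Q'(4) L(2) False by (metis prime_dvd_mult_iff primes_dvd_imp_eq)
      ultimately show ?thesis
        using P(2) order Q'(3)
        by (intro exI[of _ P] exI[of _ a] exI[of _ "m * card L"]) (simp add: mult.assoc)
    qed
  qed
qed

section \<open>Normalizers and the existence of subgroups of prime index\<close>

context group
begin

lemma conj_inj: "x \<in> carrier G \<Longrightarrow> inj_on (\<lambda>y. x \<otimes> y \<otimes> inv x) (carrier G)"
  by (auto intro!: inj_onI)

text \<open>This is the normalizer, described by one inclusion: as \<open>R\<close> is finite, an
  injective map of \<open>R\<close> into itself is onto, which gives closure under inverses.\<close>

lemma subgroup_normalizing: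
  assumes fin: "finite (carrier G)" and R: "subgroup R G"
  shows "subgroup {g \<in> carrier G. \<forall>y\<in>R. g \<otimes> y \<otimes> inv g \<in> R} G" (is "subgroup ?M G")
proof
  interpret R: subgroup R G by fact
  show "?M \<subseteq> carrier G" by auto
  show "\<one> \<in> ?M" by auto
  show "g \<otimes> h \<in> ?M" if g: "g \<in> ?M" and h: "h \<in> ?M" for g h
  proof -
    have "g \<otimes> h \<otimes> y \<otimes> inv (g \<otimes> h) = g \<otimes> (h \<otimes> y \<otimes> inv h) \<otimes> inv g" if "y \<in> R" for y
      using that g h by (simp add: inv_mult_group m_assoc)
    then show ?thesis using g h by auto
  qed
  show "inv g \<in> ?M" if g: "g \<in> ?M" for g
  proof -
    have gc: "g \<in> carrier G" using g by simp
    have "(\<lambda>y. g \<otimes> y \<otimes> inv g) ` R = R"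
      using g fin R.subset conj_inj[OF gc]
      by (intro endo_inj_surj) (auto intro: finite_subset inj_on_subset)
    have "inv g \<otimes> y \<otimes> inv (inv g) \<in> R" if "y \<in> R" for y
    proof -
      obtain z where z: "z \<in> R" "y = g \<otimes> z \<otimes> inv g"
        using \<open>y \<in> R\<close> \<open>_ = R\<close> by blast
      then have "inv g \<otimes> y \<otimes> inv (inv g) = z"
        using gc by (simp add: m_assoc) (simp flip: m_assoc)
      then show ?thesis using z by simp
    qed
    then show ?thesis using gc by auto
  qed
qed

lemma subgroup_conj:
  assumes R: "subgroup R G" and g: "g \<in> carrier G"
  shows "subgroup ((\<lambda>y. g \<otimes> y \<otimes> inv g) ` R) G"
proof -
  interpret R: subgroup R G by fact
  have "(\<lambda>y. g \<otimes> y \<otimes> inv g) \<in> hom G G"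
  proof (rule homI)
    fix x y assume "x \<in> carrier G" "y \<in> carrier G"
    then show "g \<otimes> (x \<otimes> y) \<otimes> inv g = g \<otimes> x \<otimes> inv g \<otimes> (g \<otimes> y \<otimes> inv g)"
      using g by (simp add: m_assoc inv_solve_left') (simp flip: m_assoc)
  qed (use g in simp)
  then interpret c: group_hom G G "\<lambda>y. g \<otimes> y \<otimes> inv g"
    by unfold_locales
  show ?thesis by (rule c.subgroup_img_is_subgroup[OF R])
qed

text \<open>A Frattini argument: the conjugates of \<^term>\<open>R\<close> lie in \<^term>\<open>K\<close> and are conjugate there, so
  that \<^term>\<open>K\<close> and the normalizer of \<^term>\<open>R\<close> generate the group.\<close>

lemma normal_or_prime_index_normalizer:
  assumes fin: "finite (carrier G)" and K: "K \<lhd> G" and R: "subgroup R G" "R \<subseteq> K"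
    and p: "prime (p::nat)" and r: "prime (r::nat)" and pr: "p \<noteq> r" "card R = r" "card K = p * r"
  shows "R \<lhd> G \<or> (\<exists>M. subgroup M G \<and> order G = p * card M)"
proof -
  interpret K: normal K G by fact
  interpret R: subgroup R G by fact
  let ?K = "G\<lparr>carrier := K\<rparr>"
  interpret GK: group ?K using K.subgroup_axioms by (rule subgroup_imp_group)
  define M where "M = {g \<in> carrier G. \<forall>y\<in>R. g \<otimes> y \<otimes> inv g \<in> R}"
  have M: "subgroup M G" unfolding M_def using fin R(1) by (rule subgroup_normalizing)
  have finK: "finite (carrier ?K)" using fin K.subset by (simp add: finite_subset)
  have RK: "subgroup R ?K" using R K.subgroup_axioms by (simp add: subgroup_incl)
  have index: "card (rcosets\<^bsub>?K\<^esub> R) = p"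
    using GK.order_eq_index_mult_card[OF finK RK, of p] pr by (simp add: order_def)
  have ex: "\<exists>x\<in>K. x \<otimes> g \<in> M" if g: "g \<in> carrier G" for g
  proof -
    let ?P = "(\<lambda>y. g \<otimes> y \<otimes> inv g) ` R"
    have "?P \<subseteq> K" using g R(2) K.inv_op_closed2 by blast
    then have P: "subgroup ?P ?K"
      using subgroup_conj[OF R(1) g] K.subgroup_axioms by (simp add: subgroup_incl)
    \<comment> \<open>The conjugate of R is an r-group and the index p of R in K is prime to r, so
      some x in K conjugates it back into R.\<close>
    have "card ?P = r ^ 1"
      using conj_inj[OF g] R.subset pr(2) by (simp add: card_image inj_on_subset)
    moreover have "\<not> r dvd card (rcosets\<^bsub>?K\<^esub> R)"
      using index pr(1) p r by (metis primes_dvd_imp_eq)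
    ultimately obtain x where x: "x \<in> K" "\<And>y. y \<in> ?P \<Longrightarrow> x \<otimes> y \<otimes> inv\<^bsub>?K\<^esub> x \<in> R"
      using GK.prime_power_subgroup_conj_into[OF finK RK P r, of 1] by auto
    have "x \<otimes> g \<otimes> y \<otimes> inv (x \<otimes> g) \<in> R" if y: "y \<in> R" for y
    proof -
      have "x \<otimes> (g \<otimes> y \<otimes> inv g) \<otimes> inv x \<in> R"
        using x y m_inv_consistent[OF K.subgroup_axioms x(1)] by auto
      then show ?thesis using x(1) y g by (simp add: inv_mult_group m_assoc)
    qed
    then show ?thesis using x(1) g by (intro bexI[of _ x]) (auto simp: M_def)
  qed
  have KM: "K <#> M = carrier G"
  proof
    show "K <#> M \<subseteq> carrier G"
      using K.subset subgroup.subset[OF M] by (rule set_mult_closed)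
    show "carrier G \<subseteq> K <#> M"
    proof
      fix g assume g: "g \<in> carrier G"
      then obtain x where x: "x \<in> K" "x \<otimes> g \<in> M" using ex by blast
      have "g = inv x \<otimes> (x \<otimes> g)" using x(1) g by (simp flip: m_assoc)
      then show "g \<in> K <#> M" using x unfolding set_mult_def by blast
    qed
  qed
  have KM_sub: "subgroup (K \<inter> M) G" using K.subgroup_axioms M by (rule subgroups_Inter_pair)
  have "R \<subseteq> M" by (auto simp: M_def)
  then have "K \<inter> M = R \<or> K \<inter> M = K"
    using subgroup_between_prime_index[OF fin R(1) KM_sub K.subgroup_axioms _ _ p] R(2) pr by auto
  then show ?thesis
  proof
    assume "K \<inter> M = R"
    then have "order G * r = p * r * card M"
      using card_set_mult_subgroups[OF fin K.subgroup_axioms M] KM pr by (simp add: order_def)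
    then have "order G = p * card M" using prime_gt_0_nat[OF r] by simp
    then show ?thesis using M by blast
  next
    \<comment> \<open>Then K lies in M, so G = KM = M normalizes R.\<close>
    assume "K \<inter> M = K"
    then have "K <#> M \<subseteq> M" using subgroup.m_closed[OF M] by (auto simp: set_mult_def)
    then have "carrier G \<subseteq> M" using KM by simp
    then have "R \<lhd> G" using R(1) unfolding normal_inv_iff M_def by blast
    then show ?thesis ..
  qed
qed

end

text \<open>Only the index has to be achieved, since \<open>supersoluble_subgroup\<close> makes
  every subgroup supersoluble.\<close>

lemma ex_prime_index_subgroup_of_supersoluble:
  assumes "group G" "finite (carrier G)" "supersoluble G"
    and p: "prime (p::nat)" and "p dvd order G"
  shows "\<exists>H. subgroup H G \<and> order G = p * card H"
  using assms(1-3,5)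
proof (induction "order G" arbitrary: G rule: less_induct)
  case less
  interpret group G by fact
  note fin = less.prems(2)
  \<comment> \<open>The induction step for any normal N of prime order: preimages keep the index. It
    serves below for two different choices of N.\<close>
  have lift: "\<exists>H. subgroup H G \<and> order G = p * card H"
    if N: "N \<lhd> G" "prime (card N)" and G': "group_hom G G' h" "h ` carrier G = carrier G'" "kernel G G' h = N"
      and dvd: "p dvd order G'" for N h and G' :: "('a, 'b) monoid_scheme"
  proof -
    interpret h: group_hom G G' h by fact
    have fin': "finite (carrier G')" using fin G'(2) by (metis finite_imageI)
    have order: "order G = order G' * card N"
      using h.order_eq_mult_card_kernel[OF fin G'(2)] G'(3) by simp
    have "order G' > 0" using fin' by (simp add: h.H.order_gt_0_iff_finite)
    then have "order G' < order G" using order prime_gt_1_nat[OF N(2)] by simp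
    then obtain H where H: "subgroup H G'" "order G' = p * card H"
      using less.hyps[of G'] h.H.is_group fin' h.supersoluble_image[OF fin G'(2) less.prems(3)] dvd
      by blast
    have "order G = p * card {x \<in> carrier G. h x \<in> H}"
      using h.card_vimage[OF fin G'(2) H(1)] order G'(3) H(2) by (simp add: mult.assoc)
    then show ?thesis using h.subgroup_vimage[OF H(1)] by blast
  qed
  have "carrier G \<noteq> {\<one>\<^bsub>G\<^esub>}"
    using less.prems(4) p by (auto simp: order_def)
  then obtain N where N: "N \<lhd> G" "prime (card N)"
    using normal_prime_subgroup_of_supersoluble[OF fin less.prems(3) normal_self] by blast
  obtain G' :: "('a, 'b) monoid_scheme" and h
    where h: "group_hom G G' h" "h ` carrier G = carrier G'" "kernel G G' h = N"
    using quotient_on_same_type[OF N(1)] by blast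
  interpret h: group_hom G G' h by fact
  have fin': "finite (carrier G')" using fin h(2) by (metis finite_imageI)
  have order: "order G = order G' * card N"
    using h.order_eq_mult_card_kernel[OF fin h(2)] h(3) by simp
  show ?case
  proof (cases "p dvd order G'")
    case True
    then show ?thesis using lift[OF N h] by blast
  next
    case False
    then have Np: "card N = p"
      using less.prems(4) order p N(2) by (metis prime_dvd_mult_iff primes_dvd_imp_eq)
    show ?thesis
    proof (cases "carrier G' = {\<one>\<^bsub>G'\<^esub>}")
      case True
      then have "order G = p * card {\<one>\<^bsub>G\<^esub>}" using order Np by (simp add: order_def)
      then show ?thesis using triv_subgroup by blast
    next
      case nontriv: False
      obtain R' where R': "R' \<lhd> G'" "prime (card R')"
        using h.H.normal_prime_subgroup_of_supersoluble[OF fin'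
            h.supersoluble_image[OF fin h(2) less.prems(3)] h.H.normal_self nontriv] by blast
      define r where "r = card R'"
      have r: "prime r" using R'(2) by (simp add: r_def)
      have "r dvd order G'"
        using h.H.card_subgroup_dvd[OF normal_imp_subgroup[OF R'(1)] h.H.subgroup_self]
          subgroup.subset[OF normal_imp_subgroup[OF R'(1)]] by (simp add: r_def order_def)
      then have pr: "p \<noteq> r" using False by auto
      define K where "K = {x \<in> carrier G. h x \<in> R'}"
      have K: "K \<lhd> G" unfolding K_def using R'(1) by (rule h.normal_vimage)
      have cardK: "card K = p * r"
        unfolding K_def using h.card_vimage[OF fin h(2) normal_imp_subgroup[OF R'(1)]] h(3) Np
        by (simp add: r_def)
      let ?K = "G\<lparr>carrier := K\<rparr>"
      \<comment> \<open>Sylow's theorem with exponent 1 and cofactor p.\<close>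
      have "\<exists>R. subgroup R ?K \<and> card R = r ^ 1"
        using sylow_thm[OF r subgroup_imp_group[OF normal_imp_subgroup[OF K]], of 1 p] cardK fin
        by (simp add: order_def K_def mult.commute)
      then obtain R where R: "subgroup R ?K" "card R = r" by auto
      then have R_sub: "subgroup R G" "R \<subseteq> K"
        using incl_subgroup[OF normal_imp_subgroup[OF K]] subgroup.subset[OF R(1)] by auto
      from normal_or_prime_index_normalizer[OF fin K R_sub p r pr R(2) cardK] show ?thesis
      proof
        assume RN: "R \<lhd> G"
        obtain G2 :: "('a, 'b) monoid_scheme" and f
          where f: "group_hom G G2 f" "f ` carrier G = carrier G2" "kernel G G2 f = R"
          using quotient_on_same_type[OF RN] by blast
        have "order G = order G2 * r"
          using group_hom.order_eq_mult_card_kernel[OF f(1) fin f(2)] f(3) R(2) by simp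
        then have "p dvd order G2"
          using less.prems(4) p r pr by (metis prime_dvd_mult_iff primes_dvd_imp_eq)
        then show ?thesis using lift[OF RN _ f] R(2) r by blast
      qed
    qed
  qed
qed

section \<open>From supersoluble subgroups of prime index to the whole group\<close>

context group
begin

text \<open>The subgroup H for the least prime p is normal, and its normal Sylow q-subgroup has
  coprime index in H, hence is normal in G; for p \<noteq> q it is Sylow in G too.\<close>

lemma ex_normal_sylow_if_prime_index_supersoluble:
  assumes fin: "finite (carrier G)"
    and idx: "\<And>p::nat. prime p \<Longrightarrow> p dvd order G \<Longrightarrow>
      \<exists>H. subgroup H G \<and> supersoluble (G\<lparr>carrier := H\<rparr>) \<and> order G = p * card H"
    and q: "prime (q::nat)" "q dvd order G"
    and max: "\<And>r::nat. prime r \<Longrightarrow> r dvd order G \<Longrightarrow> r \<le> q"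
  shows "\<exists>Q a m. Q \<lhd> G \<and> card Q = q ^ a \<and> order G = q ^ a * m \<and> \<not> q dvd m"
proof -
  define p where "p = (LEAST p::nat. prime p \<and> p dvd order G)"
  have p: "prime p" "p dvd order G"
    unfolding p_def using LeastI[of "\<lambda>p. prime p \<and> p dvd order G" q] q by auto
  have min: "p \<le> r" if "prime r" "r dvd order G" for r
    unfolding p_def using that by (simp add: Least_le)
  obtain H where H: "subgroup H G" "supersoluble (G\<lparr>carrier := H\<rparr>)" "order G = p * card H"
    using idx[OF p] by blast
  have finH: "finite H" using fin subgroup.subset[OF H(1)] by (rule finite_subset[rotated])
  have index: "card (rcosets H) = p"
    using order_eq_index_mult_card[OF fin H(1), of p] H(3) by simp
  have HN: "H \<lhd> G"
    using min H(3) by (intro normal_if_index_le_prime_divisors[OF fin H(1)]) (auto simp: index)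
  obtain Q a m where Q: "Q \<lhd> G\<lparr>carrier := H\<rparr>" "card Q = q ^ a" "card H = q ^ a * m" "\<not> q dvd m"
    using ex_normal_sylow_of_supersoluble[OF subgroup_imp_group[OF H(1)] _ H(2) q(1)] finH max H(3)
    by (auto simp: order_def)
  show ?thesis
  proof (cases "p = q")
    case True
    \<comment> \<open>The least and the largest prime divisor agree, so G is a q-group and is its
      own Sylow subgroup.\<close>
    then have "r = q" if "prime r" "r dvd order G" for r
      using that min max by (simp add: le_antisym)
    moreover have "order G > 0" using fin by (simp add: order_gt_0_iff_finite)
    moreover obtain b n where "order G = q ^ b * n" "\<not> q dvd n"
      using \<open>order G > 0\<close> q(1) by (metis multiplicity_decompose' neq0_conv not_prime_unit)
    ultimately have "order G = q ^ b"
      by (metis dvd_triv_right dvd_trans mult.right_neutral prime_factor_nat)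
    then show ?thesis
      using normal_self q(1) by (intro exI[of _ "carrier G"] exI[of _ b] exI[of _ 1]) (auto simp: order_def)
  next
    case False
    have "coprime (card Q) m"
      using Q(2,4) q(1) by (simp add: prime_imp_coprime)
    then have "Q \<lhd> G"
      using normal_if_coprime_in_normal[OF fin HN Q(1), of m] Q(2,3) by simp
    moreover have "\<not> q dvd p * m"
      using q(1) p(1) Q(4) False by (metis prime_dvd_mult_iff primes_dvd_imp_eq)
    ultimately show ?thesis
      using Q(2,3) H(3) by (intro exI[of _ Q] exI[of _ a] exI[of _ "p * m"]) auto
  qed
qed

lemma ex_normal_prime_subgroup_if_prime_index_supersoluble:
  assumes fin: "finite (carrier G)" and nontriv: "carrier G \<noteq> {\<one>}"
    and idx: "\<And>p::nat. prime p \<Longrightarrow> p dvd order G \<Longrightarrow>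
      \<exists>H. subgroup H G \<and> supersoluble (G\<lparr>carrier := H\<rparr>) \<and> order G = p * card H"
  shows "\<exists>L. L \<lhd> G \<and> prime (card L)"
proof -
  have pos: "order G > 0" using fin by (simp add: order_gt_0_iff_finite)
  have "order G \<noteq> 1" using nontriv one_closed
    by (metis card_1_singletonE order_def singletonD)
  define q where "q = Max (prime_factors (order G))"
  have "prime_factors (order G) \<noteq> {}"
    using \<open>order G \<noteq> 1\<close> pos by (simp add: prime_factorization_empty_iff)
  then have "q \<in> prime_factors (order G)" unfolding q_def by (intro Max_in) auto
  then have q: "prime q" "q dvd order G" by auto
  have max: "r \<le> q" if "prime r" "r dvd order G" for r
    unfolding q_def using that pos by (intro Max_ge) (auto simp: prime_factors_dvd)
  obtain Q a m where Q: "Q \<lhd> G" "card Q = q ^ a" "order G = q ^ a * m" "\<not> q dvd m"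
    using ex_normal_sylow_if_prime_index_supersoluble[OF fin idx q max] by blast
  interpret Q: normal Q G by fact
  obtain H where H: "subgroup H G" "supersoluble (G\<lparr>carrier := H\<rparr>)" "order G = q * card H"
    using idx[OF q] by blast
  interpret H: subgroup H G by fact
  have "a \<noteq> 0" using q Q(3,4) by (cases a) auto
  \<comment> \<open>The index q of H removes one factor q from the order, so q^a no longer divides
    |H|.\<close>
  have QH: "\<not> Q \<subseteq> H"
  proof
    assume "Q \<subseteq> H"
    then obtain k where "card H = q ^ a * k"
      using card_subgroup_dvd[OF Q.subgroup_axioms H(1)] Q(2) by (auto elim: dvdE)
    then have "q ^ a * m = q ^ a * (q * k)" using Q(3) H(3) by (metis mult.left_commute)
    then show False using Q(4) q(1) by (simp add: prime_gt_0_nat)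
  qed
  let ?Q = "G\<lparr>carrier := Q\<rparr>"
  interpret GQ: group ?Q using Q.subgroup_axioms by (rule subgroup_imp_group)
  define Z where "Z = {z \<in> Q. \<forall>g\<in>Q. g \<otimes> z = z \<otimes> g}"
  have orderQ: "order ?Q = q ^ a" "order ?Q \<noteq> 1"
    using Q(2) \<open>a \<noteq> 0\<close> prime_gt_1_nat[OF q(1)] by (auto simp: order_def)
  obtain z where "z \<in> carrier ?Q" "z \<noteq> \<one>\<^bsub>?Q\<^esub>"
    "\<And>g. g \<in> carrier ?Q \<Longrightarrow> g \<otimes>\<^bsub>?Q\<^esub> z = z \<otimes>\<^bsub>?Q\<^esub> g"
    using GQ.prime_power_group_has_central_element[OF q(1) orderQ] by metis
  then have z: "z \<in> Z" "z \<noteq> \<one>" by (simp_all add: Z_def)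
  have Z_sub: "subgroup Z G"
  proof
    show "Z \<subseteq> carrier G" using Q.subset by (auto simp: Z_def)
    show "\<one> \<in> Z" by (auto simp: Z_def)
    show "x \<otimes> y \<in> Z" if xy: "x \<in> Z" "y \<in> Z" for x y
    proof -
      have Q: "x \<in> Q" "y \<in> Q" using xy by (auto simp: Z_def)
      have "g \<otimes> (x \<otimes> y) = x \<otimes> y \<otimes> g" if g: "g \<in> Q" for g
      proof -
        have "g \<otimes> x = x \<otimes> g" "g \<otimes> y = y \<otimes> g" using xy g by (auto simp: Z_def)
        then show ?thesis using Q g by (metis Q.mem_carrier m_assoc)
      qed
      then show ?thesis using Q by (simp add: Z_def)
    qed
    show "inv x \<in> Z" if x: "x \<in> Z" for x
    proof -
      have Q: "x \<in> Q" using x by (simp add: Z_def)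
      have "g \<otimes> inv x = inv x \<otimes> g" if g: "g \<in> Q" for g
      proof -
        have "inv (inv g \<otimes> x) = inv (x \<otimes> inv g)" using x g by (simp add: Z_def)
        then show ?thesis using Q g by (simp add: inv_mult_group)
      qed
      then show ?thesis using Q by (simp add: Z_def)
    qed
  qed
  have conjZ: "x \<otimes> z \<otimes> inv x \<in> Z" if x: "x \<in> carrier G" and z: "z \<in> Z" for x z
  proof -
    have zQ: "z \<in> Q" using z by (simp add: Z_def)
    have "g \<otimes> (x \<otimes> z \<otimes> inv x) = x \<otimes> z \<otimes> inv x \<otimes> g" if g: "g \<in> Q" for g
    proof -
      \<comment> \<open>Commuting with g is moved back by x: z commutes with the conjugate of g,
        which is in the normal subgroup Q.\<close>
      have c: "inv x \<otimes> g \<otimes> x \<in> Q" using Q.inv_op_closed1[OF x g] .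
      then have "inv x \<otimes> g \<otimes> x \<otimes> z = z \<otimes> (inv x \<otimes> g \<otimes> x)" using z by (simp add: Z_def)
      moreover have "g \<otimes> (x \<otimes> z \<otimes> inv x) = x \<otimes> (inv x \<otimes> g \<otimes> x \<otimes> z) \<otimes> inv x"
        using x g zQ by (simp flip: m_assoc)
      moreover have "x \<otimes> (z \<otimes> (inv x \<otimes> g \<otimes> x)) \<otimes> inv x = x \<otimes> z \<otimes> inv x \<otimes> g"
        using x g zQ by (simp add: m_assoc)
      ultimately show ?thesis by simp
    qed
    then show ?thesis using Q.inv_op_closed2[OF x zQ] by (simp add: Z_def)
  qed
  have ZN: "Z \<lhd> G" using Z_sub conjZ by (simp add: normal_inv_iff)
  show ?thesis
  proof (cases "Z \<inter> H = {\<one>}")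
    case True
    have "card (Z <#> H) = card Z * card H"
      using card_set_mult_subgroups[OF fin Z_sub H(1)] True by simp
    \<comment> \<open>The product ZH has |Z||H| elements inside a group of order q|H|, so |Z| is at
      most q; as a nontrivial q-group, Z then has order exactly q.\<close>
    moreover have "card (Z <#> H) \<le> q * card H"
      using card_mono[OF fin set_mult_closed[OF subgroup.subset[OF Z_sub] H.subset]] H(3)
      by (simp add: order_def)
    ultimately have "card Z \<le> q" using card_subgroup_pos[OF fin H(1)] by simp
    moreover have "card Z dvd q ^ a"
      using card_subgroup_dvd[OF Z_sub Q.subgroup_axioms] Q(2) by (auto simp: Z_def)
    then obtain i where i: "card Z = q ^ i" using divides_primepow_nat[OF q(1)] by auto
    moreover have "card Z \<noteq> 1"
      using z subgroup.one_closed[OF Z_sub] by (metis card_1_singletonE singletonD)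
    then have "i \<noteq> 0" using i by auto
    ultimately have "q dvd card Z" "card Z \<le> q" "card Z > 0"
      using card_subgroup_pos[OF fin Z_sub] by auto
    then have "card Z = q" using dvd_imp_le le_antisym by blast
    then show ?thesis using ZN q(1) by blast
  next
    case False
    let ?H = "G\<lparr>carrier := H\<rparr>"
    interpret GH: group ?H using H(1) by (rule subgroup_imp_group)
    have "Z \<inter> H \<lhd> ?H" using normal_Int_subgroup[OF H(1) ZN] .
    moreover have "finite (carrier ?H)" using fin H.subset by (simp add: finite_subset)
    moreover have "Z \<inter> H \<noteq> {\<one>\<^bsub>?H\<^esub>}" using False by simp
    ultimately obtain L where L: "L \<lhd> ?H" "L \<subseteq> Z \<inter> H" "prime (card L)"
      using GH.normal_prime_subgroup_of_supersoluble[OF _ H(2)] by blast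
    have L_sub: "subgroup L G" using incl_subgroup[OF H(1) normal_imp_subgroup[OF L(1)]] .
    let ?M = "{g \<in> carrier G. \<forall>y\<in>L. g \<otimes> y \<otimes> inv g \<in> L}"
    have M: "subgroup ?M G" using fin L_sub by (rule subgroup_normalizing)
    have "H \<subseteq> ?M"
      using L(1) m_inv_consistent[OF H(1)] by (auto simp: GH.normal_inv_iff)
    moreover have "Q \<subseteq> ?M"
    proof
      fix g assume g: "g \<in> Q"
      have "g \<otimes> y \<otimes> inv g = y" if "y \<in> L" for y
      proof -
        have "y \<in> Q" "g \<otimes> y = y \<otimes> g" using L(2) that g by (auto simp: Z_def)
        then show ?thesis using g by (simp add: m_assoc)
      qed
      then show "g \<in> ?M" using g by auto
    qed
    \<comment> \<open>H has prime index, and the normalizer of L contains H as well as Q, which is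
      not inside H.\<close>
    ultimately have "?M = carrier G"
      using subgroup_between_prime_index[OF fin H(1) M subgroup_self _ _ q(1)] H(3) QH
      by (auto simp: order_def)
    then have "L \<lhd> G" using L_sub unfolding normal_inv_iff by blast
    then show ?thesis using L(3) by blast
  qed
qed

end

lemma supersoluble_if_prime_index_supersoluble:
  assumes "group G" "finite (carrier G)"
    and "\<And>p::nat. prime p \<Longrightarrow> p dvd order G \<Longrightarrow>
      \<exists>H. subgroup H G \<and> supersoluble (G\<lparr>carrier := H\<rparr>) \<and> order G = p * card H"
  shows "supersoluble G"
  using assms
proof (induction "order G" arbitrary: G rule: less_induct)
  case less
  interpret group G by fact
  note fin = less.prems(2) and idx = less.prems(3)
  show ?case
  proof (cases "carrier G = {\<one>\<^bsub>G\<^esub>}")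
    case True
    then show ?thesis by (simp add: supersoluble_iff_prime_steps[OF fin])
  next
    case False
    obtain L where L: "L \<lhd> G" "prime (card L)"
      using ex_normal_prime_subgroup_if_prime_index_supersoluble[OF fin False idx] by blast
    obtain G' :: "('a, 'b) monoid_scheme" and h
      where h: "group_hom G G' h" "h ` carrier G = carrier G'" "kernel G G' h = L"
      using quotient_on_same_type[OF L(1)] by blast
    interpret h: group_hom G G' h by fact
    have fin': "finite (carrier G')" using fin h(2) by (metis finite_imageI)
    have order: "order G = order G' * card L"
      using h.order_eq_mult_card_kernel[OF fin h(2)] h(3) by simp
    have "order G' > 0" using fin' by (simp add: h.H.order_gt_0_iff_finite)
    then have less': "order G' < order G" using order prime_gt_1_nat[OF L(2)] by simp
    have image: "subgroup (h ` H) G'" "supersoluble (G'\<lparr>carrier := h ` H\<rparr>)"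
      if H: "subgroup H G" "supersoluble (G\<lparr>carrier := H\<rparr>)" for H
    proof -
      interpret H: subgroup H G by fact
      show sub: "subgroup (h ` H) G'" using H(1) by (rule h.subgroup_img_is_subgroup)
      interpret r: group_hom "G\<lparr>carrier := H\<rparr>" "G'\<lparr>carrier := h ` H\<rparr>" h
        using subgroup_imp_group[OF H(1)] h.H.subgroup_imp_group[OF sub]
        by (auto simp: group_hom_def group_hom_axioms_def hom_def)
      show "supersoluble (G'\<lparr>carrier := h ` H\<rparr>)"
        using fin H.subset H(2) by (intro r.supersoluble_image) (auto intro: finite_subset)
    qed
    have "supersoluble G'"
    \<comment> \<open>If such an H does not contain L, then HL = G and G/L is an image of H.
      Otherwise every such H contains L, its index is preserved in G/L, and induction
      applies.\<close>
    proof (cases "\<exists>H p::nat. prime p \<and> subgroup H G \<and> supersoluble (G\<lparr>carrier := H\<rparr>) \<and>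
          order G = p * card H \<and> \<not> L \<subseteq> H")
      case True
      then obtain H and p :: nat where H: "prime p" "subgroup H G" "supersoluble (G\<lparr>carrier := H\<rparr>)"
        "order G = p * card H" "\<not> L \<subseteq> H" by blast
      \<comment> \<open>This preimage is the product HL; it exceeds H because it contains L.\<close>
      let ?M = "{x \<in> carrier G. h x \<in> h ` H}"
      have "L \<subseteq> ?M"
        using h(3) subgroup.one_closed[OF image(1)[OF H(2,3)]] by (auto simp: kernel_def)
      moreover have "H \<subseteq> ?M" using subgroup.subset[OF H(2)] by auto
      moreover have "?M = H \<or> ?M = carrier G" if "H \<subseteq> ?M"
        using that H(4) unfolding order_def
        by (intro subgroup_between_prime_index[OF fin H(2) h.subgroup_vimage[OF image(1)[OF H(2,3)]]
              subgroup_self _ _ H(1)]) auto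
      ultimately have "?M = carrier G" using H(5) by metis
      then have "h x \<in> h ` H" if "x \<in> carrier G" for x using that by blast
      then have "carrier G' \<subseteq> h ` H" unfolding h(2)[symmetric] by (rule image_subsetI)
      then have "h ` H = carrier G'" using subgroup.subset[OF image(1)[OF H(2,3)]] by blast
      then show ?thesis using image(2)[OF H(2,3)] by simp
    next
      case False
      show ?thesis
      proof (rule less.hyps[OF less' h.H.is_group fin'])
        fix p :: nat assume p: "prime p" "p dvd order G'"
        then obtain H where H: "subgroup H G" "supersoluble (G\<lparr>carrier := H\<rparr>)" "order G = p * card H"
          using idx[of p] order by auto
        then have "L \<subseteq> H" using False p(1) by blast
        then have "card H = card (h ` H) * card L"
          using h.card_image_mult_kernel[OF fin H(1)] h(3) by (simp add: Int_absorb1)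
        then have "order G' = p * card (h ` H)"
          using order H(3) prime_gt_0_nat[OF L(2)] by simp
        then show "\<exists>H. subgroup H G' \<and> supersoluble (G'\<lparr>carrier := H\<rparr>) \<and> order G' = p * card H"
          using image[OF H(1,2)] by blast
      qed
    qed
    then show ?thesis
      using h.supersoluble_extension[OF fin h(2)] h(3) L(2) by simp
  qed
qed

theorem theorem1:
  fixes G :: "('a, 'b) monoid_scheme"
  assumes "group G" and "finite (carrier G)"
  shows "supersoluble G \<longleftrightarrow>
    (\<forall>p::nat. Factorial_Ring.prime p \<and> p dvd order G \<longrightarrow>
       (\<exists>H. subgroup H G \<and> supersoluble (G\<lparr>carrier := H\<rparr>) \<and> card (rcosets\<^bsub>G\<^esub> H) = p))"
proof -
  interpret group G by fact
  \<comment> \<open>The index is expressed by orders throughout and turned into a number of cosets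
    only at the end.\<close>
  have "supersoluble G \<longleftrightarrow>
    (\<forall>p::nat. prime p \<and> p dvd order G \<longrightarrow>
       (\<exists>H. subgroup H G \<and> supersoluble (G\<lparr>carrier := H\<rparr>) \<and> order G = p * card H))"
    using supersoluble_if_prime_index_supersoluble[OF assms]
      ex_prime_index_subgroup_of_supersoluble[OF assms] supersoluble_subgroup[OF assms(2)]
    by blast
  then show ?thesis using order_eq_index_mult_card[OF assms(2)] by blast
qed

end
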